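(* Let $M$ be a set, $A:M\to[0,\infty)$ and $B:M\to\mathbb{R}$ be such that the triple $(M,A,B)$ is adequate, and let $\eta: (0,\infty) \to (0,\infty)$. The following are equivalent: (a) for all $N>0$ and all $s \geq \eta(N)$, $\varphi_{(M,A,B)}(s) \geq Ns$; (b) there exists a classical modulus $\varphi$ for $(M,A,B)$ such that for all $N>0$ and all $s \geq \eta(N)$, $\varphi(s) \geq Ns$; (c) there exists a modulus $\psi$ for $(M,A,B)$ such that for all $N>0$ and all $s \geq \eta(N)$ such that there is an $x \in M$ with $A(x) \geq s$, $\psi(s) \geq Ns$; (d) for all $N>0$, all $s\geq \eta(N)$ and all $x \in M$ with $A(x) \geq s$, $B(x) \geq Ns$; (e) for all $N>0$ and all $x \in M$ with $A(x) \geq \eta(N)$, $B(x) \geq N \cdot A(x)$.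
   Context: For a set $M$, $A:M\to[0,\infty)$ and $B:M\to\mathbb{R}$, define $\varphi_{(M,A,B)}:[0,\infty)\to[-\infty,\infty]$ by $\varphi_{(M,A,B)}(\varepsilon):=\inf\{B(y)\mid y\in M,\ A(y)\ge\varepsilon\}$ if $\varepsilon>0$, and $\varphi_{(M,A,B)}(0):=\min(0,\inf\{B(y)\mid y\in M\})$ (with $\inf\emptyset=\infty$). The triple $(M,A,B)$ is adequate if $\varphi_{(M,A,B)}(0)=0$ and $\varphi_{(M,A,B)}(\varepsilon)>0$ for all $\varepsilon>0$. A classical modulus for $(M,A,B)$ is a function $\varphi:[0,\infty)\to[0,\infty]$ which is nondecreasing and vanishes only at $0$ (i.e. $\varphi(t)=0$ iff $t=0$) such that $\varphi(A(x))\le B(x)$ for all $x\in M$. A modulus for $(M,A,B)$ is a function $\psi:(0,\infty)\to(0,\infty)$ such that, for all $x\in M$ and all $\varepsilon>0$ with $A(x)\ge\varepsilon$, $\psi(\varepsilon)\le B(x)$. *)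

theory Defs
  imports "HOL-Library.Extended_Real"
begin

text \<open>
  Functions with domain \<open>[0,\<infinity>)\<close> or \<open>(0,\<infinity>)\<close> are total functions on the reals; all conditions
  on them are restricted to the intended domain, and their values outside it are irrelevant.
  Values in \<open>[-\<infinity>,\<infinity>]\<close> and \<open>[0,\<infinity>]\<close> are of type \<^typ>\<open>ereal\<close>, where the infimum
  of the empty set is \<open>\<infinity>\<close>.
\<close>

definition phi :: "'a set \<Rightarrow> ('a \<Rightarrow> real) \<Rightarrow> ('a \<Rightarrow> real) \<Rightarrow> real \<Rightarrow> ereal" where
  "phi M A B \<epsilon> =
     (if \<epsilon> > 0 then Inf {ereal (B y) | y. y \<in> M \<and> A y \<ge> \<epsilon>}
      else min 0 (Inf {ereal (B y) | y. y \<in> M}))"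

definition adequate :: "'a set \<Rightarrow> ('a \<Rightarrow> real) \<Rightarrow> ('a \<Rightarrow> real) \<Rightarrow> bool" where
  "adequate M A B \<longleftrightarrow> phi M A B 0 = 0 \<and> (\<forall>\<epsilon>>0. phi M A B \<epsilon> > 0)"

definition classical_modulus ::
  "'a set \<Rightarrow> ('a \<Rightarrow> real) \<Rightarrow> ('a \<Rightarrow> real) \<Rightarrow> (real \<Rightarrow> ereal) \<Rightarrow> bool" where
  "classical_modulus M A B \<phi> \<longleftrightarrow>
     (\<forall>t\<ge>0. \<phi> t \<ge> 0) \<and>
     mono_on {0..} \<phi> \<and>
     (\<forall>t\<ge>0. \<phi> t = 0 \<longleftrightarrow> t = 0) \<and>
     (\<forall>x\<in>M. \<phi> (A x) \<le> ereal (B x))"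

definition modulus ::
  "'a set \<Rightarrow> ('a \<Rightarrow> real) \<Rightarrow> ('a \<Rightarrow> real) \<Rightarrow> (real \<Rightarrow> real) \<Rightarrow> bool" where
  "modulus M A B \<psi> \<longleftrightarrow>
     (\<forall>\<epsilon>>0. \<psi> \<epsilon> > 0) \<and>
     (\<forall>x\<in>M. \<forall>\<epsilon>>0. A x \<ge> \<epsilon> \<longrightarrow> \<psi> \<epsilon> \<le> B x)"

end

theory Submission
  imports Defs
begin

text \<open>For \<open>s > 0\<close>, a number bounds \<open>phi M A B s\<close> from below exactly
  when it bounds \<open>B x\<close> for every \<open>x\<close> in \<open>M\<close> with
  \<open>A x \<ge> s\<close> (\<open>le_phi_iff\<close>). With the bound \<open>N * s\<close>, this
  identifies (a) with (d). Moreover \<open>phi\<close> is the largest possible modulus at positive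
  arguments: any classical modulus (by monotonicity) and any modulus is below \<open>B x\<close> at
  each such point, so (b) and (c) each give (d). Conversely, adequacy makes \<open>phi\<close>
  itself a classical modulus (\<open>classical_modulus_phi\<close>) and its real-valued version
  \<open>real_phi\<close> a modulus (\<open>modulus_real_phi\<close>), and these witness (b) and (c)
  once (a) holds. Finally, (d) and (e) differ only in whether the linear bound is taken at a
  threshold \<open>s\<close> or at \<open>A x\<close> itself.\<close>

lemma le_phi_iff:
  assumes "\<epsilon> > 0"
  shows "c \<le> phi M A B \<epsilon> \<longleftrightarrow> (\<forall>x\<in>M. A x \<ge> \<epsilon> \<longrightarrow> c \<le> ereal (B x))"
  using assms by (auto simp: phi_def le_Inf_iff)

lemma phi_le:
  assumes "x \<in> M" "A x \<ge> \<epsilon>" "\<epsilon> \<ge> 0"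
  shows "phi M A B \<epsilon> \<le> ereal (B x)"
proof (cases "\<epsilon> = 0")
  case True
  have "Inf {ereal (B y) | y. y \<in> M} \<le> ereal (B x)"
    using assms by (intro Inf_lower) auto
  then show ?thesis
    using True by (auto simp: phi_def min_le_iff_disj)
next
  case False
  then show ?thesis
    using assms le_phi_iff[of \<epsilon> "phi M A B \<epsilon>" M A B] by auto
qed

text \<open>Raising the threshold shrinks the set over which the infimum is taken, which gives
  monotonicity; adequacy says precisely that the value is zero at 0 and positive elsewhere.\<close>

lemma classical_modulus_phi:
  assumes A_nonneg: "\<forall>x\<in>M. A x \<ge> 0" and adequate: "adequate M A B"
  shows "classical_modulus M A B (phi M A B)"
proof -
  have zero: "phi M A B 0 = 0" and pos: "\<And>t. t > 0 \<Longrightarrow> phi M A B t > 0"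
    using adequate by (auto simp: adequate_def)
  have nonneg: "phi M A B t \<ge> 0" if "t \<ge> 0" for t
    using that zero pos[of t] by (cases "t = 0") auto
  have "mono_on {0..} (phi M A B)"
  proof (rule mono_onI)
    fix r s :: real
    assume rs: "r \<in> {0..}" "s \<in> {0..}" "r \<le> s"
    show "phi M A B r \<le> phi M A B s"
    proof (cases "s = 0")
      case True
      with rs show ?thesis by simp
    next
      case False
      with rs have "s > 0" by simp
      with rs show ?thesis
        by (auto simp: le_phi_iff intro: phi_le)
    qed
  qed
  moreover have "phi M A B t = 0 \<longleftrightarrow> t = 0" if "t \<ge> 0" for t
    using that zero pos[of t] by (cases "t = 0") auto
  ultimately show ?thesis
    using nonneg A_nonneg by (auto simp: classical_modulus_def intro: phi_le)
qed

text \<open>\<^term>\<open>phi M A B \<epsilon>\<close> is \<open>\<infinity>\<close> when no point has \<open>A x \<ge> \<epsilon>\<close>; any positive value works there.\<close>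

definition real_phi :: "'a set \<Rightarrow> ('a \<Rightarrow> real) \<Rightarrow> ('a \<Rightarrow> real) \<Rightarrow> real \<Rightarrow> real" where
  "real_phi M A B \<epsilon> = (if \<exists>x\<in>M. A x \<ge> \<epsilon> then real_of_ereal (phi M A B \<epsilon>) else 1)"

text \<open>Adequacy bounds \<open>phi M A B \<epsilon>\<close> below by 0 and the point
  \<open>x\<close> bounds it above by \<open>B x\<close>, so it is finite and the conversion to a
  real loses nothing.\<close>

lemma ereal_real_phi:
  assumes "adequate M A B" "\<epsilon> > 0" "x \<in> M" "A x \<ge> \<epsilon>"
  shows "ereal (real_phi M A B \<epsilon>) = phi M A B \<epsilon>"
proof -
  have "0 < phi M A B \<epsilon>" "phi M A B \<epsilon> \<le> ereal (B x)"
    using assms by (auto simp: adequate_def intro: phi_le)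
  then have "\<bar>phi M A B \<epsilon>\<bar> \<noteq> \<infinity>" by auto
  then show ?thesis
    using assms by (auto simp: real_phi_def ereal_real')
qed

lemma modulus_real_phi:
  assumes "adequate M A B"
  shows "modulus M A B (real_phi M A B)"
  unfolding modulus_def
proof (intro conjI allI impI ballI)
  fix \<epsilon> :: real
  assume eps: "\<epsilon> > 0"
  show "real_phi M A B \<epsilon> > 0"
  proof (cases "\<exists>x\<in>M. A x \<ge> \<epsilon>")
    case True
    then have "ereal (real_phi M A B \<epsilon>) = phi M A B \<epsilon>"
      using ereal_real_phi[OF assms eps] by blast
    then have "ereal (real_phi M A B \<epsilon>) > 0"
      using assms eps by (simp add: adequate_def del: ereal_less)
    then show ?thesis by simp
  qed (simp add: real_phi_def)
next
  fix x and \<epsilon> :: real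
  assume x: "x \<in> M" and eps: "\<epsilon> > 0" "A x \<ge> \<epsilon>"
  have "ereal (real_phi M A B \<epsilon>) \<le> ereal (B x)"
    using ereal_real_phi[OF assms eps(1) x eps(2)] phi_le[of x M \<epsilon> A B] x eps by simp
  then show "real_phi M A B \<epsilon> \<le> B x" by simp
qed

theorem proposition4p1:
  fixes M :: "'a set" and A B :: "'a \<Rightarrow> real" and \<eta> :: "real \<Rightarrow> real"
  assumes A_nonneg: "\<forall>x\<in>M. A x \<ge> 0"
    and adequate: "adequate M A B"
    and eta_pos: "\<forall>N>0. \<eta> N > 0"
  shows
    "let
       a = (\<forall>N>0. \<forall>s\<ge>\<eta> N. phi M A B s \<ge> ereal (N * s));
       b = (\<exists>\<phi>. classical_modulus M A B \<phi> \<and> (\<forall>N>0. \<forall>s\<ge>\<eta> N. \<phi> s \<ge> ereal (N * s)));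
       c = (\<exists>\<psi>. modulus M A B \<psi> \<and>
              (\<forall>N>0. \<forall>s\<ge>\<eta> N. (\<exists>x\<in>M. A x \<ge> s) \<longrightarrow> \<psi> s \<ge> N * s));
       d = (\<forall>N>0. \<forall>s\<ge>\<eta> N. \<forall>x\<in>M. A x \<ge> s \<longrightarrow> B x \<ge> N * s);
       e = (\<forall>N>0. \<forall>x\<in>M. A x \<ge> \<eta> N \<longrightarrow> B x \<ge> N * A x)
     in (a \<longleftrightarrow> b) \<and> (b \<longleftrightarrow> c) \<and> (c \<longleftrightarrow> d) \<and> (d \<longleftrightarrow> e)"
proof -
  define a where "a \<longleftrightarrow> (\<forall>N>0. \<forall>s\<ge>\<eta> N. phi M A B s \<ge> ereal (N * s))"
  define b where "b \<longleftrightarrow>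
    (\<exists>\<phi>. classical_modulus M A B \<phi> \<and> (\<forall>N>0. \<forall>s\<ge>\<eta> N. \<phi> s \<ge> ereal (N * s)))"
  define c where "c \<longleftrightarrow>
    (\<exists>\<psi>. modulus M A B \<psi> \<and>
       (\<forall>N>0. \<forall>s\<ge>\<eta> N. (\<exists>x\<in>M. A x \<ge> s) \<longrightarrow> \<psi> s \<ge> N * s))"
  define d where "d \<longleftrightarrow> (\<forall>N>0. \<forall>s\<ge>\<eta> N. \<forall>x\<in>M. A x \<ge> s \<longrightarrow> B x \<ge> N * s)"
  define e where "e \<longleftrightarrow> (\<forall>N>0. \<forall>x\<in>M. A x \<ge> \<eta> N \<longrightarrow> B x \<ge> N * A x)"
  \<comment> \<open>Positivity of \<open>\<eta>\<close> keeps every relevant \<open>s\<close> away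
    from 0, where \<open>phi\<close> is defined by a different formula.\<close>
  have s_pos: "s > 0" if "N > 0" "s \<ge> \<eta> N" for N s
    using eta_pos that by force
  have "a \<longleftrightarrow> d"
    unfolding a_def d_def using s_pos by (auto simp: le_phi_iff)
  moreover have "a \<Longrightarrow> b"
    unfolding a_def b_def using classical_modulus_phi[OF A_nonneg adequate] by blast
  moreover have "b \<Longrightarrow> d"
    unfolding b_def d_def
  proof (elim exE conjE, intro allI impI ballI)
    fix \<phi> N s x
    assume \<phi>: "classical_modulus M A B \<phi>" "\<forall>N>0. \<forall>s\<ge>\<eta> N. \<phi> s \<ge> ereal (N * s)"
      and Nsx: "(N::real) > 0" "s \<ge> \<eta> N" "x \<in> M" "A x \<ge> s"
    have "ereal (N * s) \<le> \<phi> s"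
      using \<phi>(2) Nsx by blast
    also have "\<phi> s \<le> \<phi> (A x)"
      using \<phi>(1) Nsx s_pos[of N s] by (auto simp: classical_modulus_def intro: mono_onD)
    also have "\<phi> (A x) \<le> ereal (B x)"
      using \<phi>(1) Nsx(3) by (auto simp: classical_modulus_def)
    finally show "N * s \<le> B x" by simp
  qed
  moreover have "a \<Longrightarrow> c"
    unfolding a_def c_def
  proof (intro exI[of _ "real_phi M A B"] conjI allI impI modulus_real_phi[OF adequate])
    fix N s
    assume a: "\<forall>N>0. \<forall>s\<ge>\<eta> N. phi M A B s \<ge> ereal (N * s)"
      and Ns: "(N::real) > 0" "s \<ge> \<eta> N" and "\<exists>x\<in>M. A x \<ge> s"
    then have "ereal (real_phi M A B s) = phi M A B s"
      using ereal_real_phi[OF adequate s_pos[OF Ns]] by blast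
    then have "ereal (N * s) \<le> ereal (real_phi M A B s)"
      using a Ns by simp
    then show "N * s \<le> real_phi M A B s" by simp
  qed
  \<comment> \<open>The point \<open>x\<close> at which (d) is tested also satisfies the existence
    condition in (c).\<close>
  moreover have "c \<Longrightarrow> d"
    unfolding c_def d_def modulus_def using s_pos by (meson order_trans)
  \<comment> \<open>Take \<open>s = A x\<close>.\<close>
  moreover have "d \<Longrightarrow> e"
    unfolding d_def e_def by blast
  \<comment> \<open>From \<open>A x \<ge> s \<ge> \<eta> N\<close> follows
    \<open>B x \<ge> N * A x \<ge> N * s\<close>.\<close>
  moreover have "e \<Longrightarrow> d"
    unfolding d_def e_def by (meson mult_left_mono less_imp_le order_trans)
  ultimately show ?thesis
    unfolding Let_def a_def[symmetric] b_def[symmetric] c_def[symmetric]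
      d_def[symmetric] e_def[symmetric]
    by blast
qed

end
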